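(* Let $G=(V_G,E_G)$ and $H=(V_H,E_H)$ be finite simple connected graphs with $|V_G|=n$ and $|V_H|=m$. Then $$W(G\wr H)=n^3m^{2(n-1)}W(H)+m^n\sum_{A\subseteq V_G}(m-1)^{|A|}\,W_{\rho_A}(G).$$
   Context: The wreath product $G\wr H$ has vertex set $\{(f,v): f:V_G\to V_H,\ v\in V_G\}$; $(f,v)$ and $(f',v')$ are adjacent iff either $v=v'$, $f(w)=f'(w)$ for $w\neq v$ and $f(v)\sim f'(v)$ in $H$, or $f=f'$ and $v\sim v'$ in $G$. The Wiener index of a connected graph $X$ is $W(X)=\frac12\sum_{u,v\in V_X}d_X(u,v)$, $d_X$ the geodesic distance. For $A\subseteq V_G$ and $u,v\in V_G$, $\rho_A(u,v)$ is the minimum length of a walk in $G$ from $u$ to $v$ (vertex repetitions allowed, length $\ge0$) visiting every vertex of $A$, and $W_{\rho_A}(G)=\frac12\sum_{u,v\in V_G}\rho_A(u,v)$ (sum over all ordered pairs, including $u=v$). The convention $0^0=1$ is used. *)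

theory Defs
  imports Complex_Main "HOL-Library.FuncSet" "Graph_Theory.Digraph_Component"
begin

text \<open>
  Simple graphs are rendered as finite, symmetric, loop-free relations (\<open>pair_graph\<close>): an undirected
  edge is the pair of its two orientations, and the length of an arc walk is its number of arcs.
\<close>

text \<open>
  Functions \<open>V\<^sub>G \<rightarrow> V\<^sub>H\<close> are represented by the extensional function space, so that two
  of them are equal iff they agree on \<open>V\<^sub>G\<close>.
\<close>

definition wreath_product ::
  "'a pair_pre_digraph \<Rightarrow> 'b pair_pre_digraph \<Rightarrow> (('a \<Rightarrow> 'b) \<times> 'a) pair_pre_digraph" where
  "wreath_product G H =
    \<lparr> pverts = (pverts G \<rightarrow>\<^sub>E pverts H) \<times> pverts G,
      parcs = {((f, v), (f', v')) | f v f' v'.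
        f \<in> pverts G \<rightarrow>\<^sub>E pverts H \<and> f' \<in> pverts G \<rightarrow>\<^sub>E pverts H \<and> v \<in> pverts G \<and> v' \<in> pverts G \<and>
        (v = v' \<and> (\<forall>w \<in> pverts G. w \<noteq> v \<longrightarrow> f w = f' w) \<and> (f v, f' v) \<in> parcs H \<or>
         f = f' \<and> (v, v') \<in> parcs G)} \<rparr>"

definition geodesic_dist :: "'a pair_pre_digraph \<Rightarrow> 'a \<Rightarrow> 'a \<Rightarrow> nat" where
  "geodesic_dist X u v = (LEAST k. \<exists>p. pre_digraph.awalk (with_proj X) u p v \<and> length p = k)"

definition wiener_index :: "'a pair_pre_digraph \<Rightarrow> real" where
  "wiener_index X = 1 / 2 * (\<Sum>u \<in> pverts X. \<Sum>v \<in> pverts X. real (geodesic_dist X u v))"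

definition visiting_dist :: "'a pair_pre_digraph \<Rightarrow> 'a set \<Rightarrow> 'a \<Rightarrow> 'a \<Rightarrow> nat" where
  "visiting_dist X A u v =
    (LEAST k. \<exists>p. pre_digraph.awalk (with_proj X) u p v \<and>
       A \<subseteq> set (pre_digraph.awalk_verts (with_proj X) u p) \<and> length p = k)"

definition visiting_wiener_index :: "'a pair_pre_digraph \<Rightarrow> 'a set \<Rightarrow> real" where
  "visiting_wiener_index X A =
    1 / 2 * (\<Sum>u \<in> pverts X. \<Sum>v \<in> pverts X. real (visiting_dist X A u v))"

text \<open>
  \<open>LEAST\<close> is only meaningful if some walk exists. The following facts show that this is
  the case wherever the two distances are used.
\<close>

lemma connected_awalk_ex:
  assumes "pair_graph X" and "Digraph_Component.connected (with_proj X)"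
    and "u \<in> pverts X" and "v \<in> pverts X"
  shows "\<exists>p. pre_digraph.awalk (with_proj X) u p v"
proof -
  interpret pair_graph X by fact
  have "parcs (mk_symmetric (with_proj X)) = parcs X"
    using pair_sym_arcs by (auto simp: mk_symmetric_def symmetric_def sym_def)
  then have "mk_symmetric (with_proj X) = X"
    by (simp add: mk_symmetric_def)
  then have "u \<rightarrow>\<^sup>*\<^bsub>with_proj X\<^esub> v"
    using assms(2-4) by (simp add: connected_def strongly_connected_def)
  then show ?thesis
    by (simp add: reachable_awalk)
qed

lemma connected_visiting_awalk_ex:
  assumes "pair_graph X" and "Digraph_Component.connected (with_proj X)"
    and "u \<in> pverts X" and "v \<in> pverts X" and "A \<subseteq> pverts X"
  shows "\<exists>p. pre_digraph.awalk (with_proj X) u p v \<and>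
    A \<subseteq> set (pre_digraph.awalk_verts (with_proj X) u p)"
proof -
  interpret pair_graph X by fact
  have "finite A" using assms(5) pair_finite_verts by (rule finite_subset)
  then show ?thesis using assms(3,5)
  proof (induction A arbitrary: u rule: finite_induct)
    case empty
    then show ?case using connected_awalk_ex[OF assms(1,2) _ assms(4)] by blast
  next
    case (insert a A)
    obtain p where p: "awalk u p a"
      using connected_awalk_ex[OF assms(1,2) insert.prems(1), of a] insert.prems by auto
    obtain q where q: "awalk a q v" "A \<subseteq> set (pawalk_verts a q)"
      using insert.IH[of a] insert.prems by auto
    have pq: "awalk u (p @ q) v" using p q by (simp add: awalk_appendI)
    moreover have "set (pawalk_verts u (p @ q)) = set (pawalk_verts u p) \<union> set (pawalk_verts a q)"
      using set_awalk_verts_append[OF p q(1)] by simp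
    moreover have "a \<in> set (pawalk_verts a q)" by (cases q) (use q(1) in auto)
    ultimately show ?case using q(2)
      by (metis awalk_verts_with_proj_eq Un_iff insert_subset le_supI2)
  qed
qed

lemma pair_graph_wreath_product:
  assumes "pair_graph G" and "pair_graph H"
  shows "pair_graph (wreath_product G H)"
proof -
  interpret G: pair_graph G by fact
  interpret H: pair_graph H by fact
  have fin: "finite (pverts (wreath_product G H))"
    by (simp add: wreath_product_def finite_PiE G.pair_finite_verts H.pair_finite_verts)
  have sub: "parcs (wreath_product G H) \<subseteq>
      pverts (wreath_product G H) \<times> pverts (wreath_product G H)"
    by (auto simp: wreath_product_def)
  have sG: "(b, a) \<in> parcs G" if "(a, b) \<in> parcs G" for a b
    using that G.pair_sym_arcs by (auto simp: symmetric_def sym_def)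
  have sH: "(b, a) \<in> parcs H" if "(a, b) \<in> parcs H" for a b
    using that H.pair_sym_arcs by (auto simp: symmetric_def sym_def)
  show ?thesis
  proof
    show "finite (parcs (wreath_product G H))"
      using fin sub by (meson finite_SigmaI finite_subset)
    show "symmetric (with_proj (wreath_product G H))"
      by (auto simp: symmetric_def sym_def wreath_product_def dest: sG sH)
    show "fst e \<noteq> snd e" if "e \<in> parcs (wreath_product G H)" for e
      using that by (auto simp: wreath_product_def dest: G.no_loops' H.no_loops')
  qed (use fin sub in auto)
qed

lemma connected_wreath_product:
  assumes "pair_graph G" and "Digraph_Component.connected (with_proj G)"
    and "pair_graph H" and "Digraph_Component.connected (with_proj H)"
  shows "Digraph_Component.connected (with_proj (wreath_product G H))"
proof -
  interpret G: pair_graph G by fact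
  interpret H: pair_graph H by fact
  interpret W: pair_graph "wreath_product G H" using assms(1,3) by (rule pair_graph_wreath_product)
  let ?F = "pverts G \<rightarrow>\<^sub>E pverts H" and ?W = "with_proj (wreath_product G H)"
  have move: "(f, v) \<rightarrow>\<^sup>*\<^bsub>?W\<^esub> (f, v')" if f: "f \<in> ?F" and v: "v \<in> pverts G" "v' \<in> pverts G" for f v v'
  proof -
    have "v \<rightarrow>\<^sup>*\<^bsub>with_proj G\<^esub> v'"
      using connected_awalk_ex[OF assms(1,2) v] by (simp add: G.reachable_awalk)
    then show ?thesis
    proof (induction rule: G.reachable_induct)
      case base
      then show ?case using f v by (intro W.reachable_refl) (simp add: wreath_product_def)
    next
      case (step x y)
      then have "((f, x), (f, y)) \<in> parcs (wreath_product G H)"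
        using f by (auto simp: wreath_product_def dest: G.in_arcsD1 G.in_arcsD2)
      then show ?case using step.IH W.reachable_adj_trans by simp
    qed
  qed
  have lamp: "(f, v) \<rightarrow>\<^sup>*\<^bsub>?W\<^esub> (f(v := b), v)"
    if f: "f \<in> ?F" and v: "v \<in> pverts G" and b: "b \<in> pverts H" for f v b
  proof -
    have "f v \<in> pverts H" using f v by auto
    then have "f v \<rightarrow>\<^sup>*\<^bsub>with_proj H\<^esub> b"
      using connected_awalk_ex[OF assms(3,4) _ b] by (simp add: H.reachable_awalk)
    then show ?thesis
    proof (induction rule: H.reachable_induct)
      case base
      then show ?case using move[OF f v v] by simp
    next
      case (step x y)
      then have xy: "(x, y) \<in> parcs H" by simp
      then have "f(v := x) \<in> ?F" "f(v := y) \<in> ?F"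
        using f v by (auto simp: PiE_iff extensional_def dest: H.in_arcsD1 H.in_arcsD2)
      then have "((f(v := x), v), (f(v := y), v)) \<in> parcs (wreath_product G H)"
        using v xy by (auto simp: wreath_product_def)
      then show ?case using step.IH W.reachable_adj_trans by metis
    qed
  qed
  have upd: "(f, v) \<rightarrow>\<^sup>*\<^bsub>?W\<^esub> (override_on f g S, v) \<and> override_on f g S \<in> ?F"
    if "finite S" "S \<subseteq> pverts G" and f: "f \<in> ?F" "g \<in> ?F" and v: "v \<in> pverts G" for f g S v
    using that(1,2)
  proof (induction S rule: finite_induct)
    case empty
    then show ?case using move[OF f(1) v v] f by simp
  next
    case (insert a S)
    let ?h = "override_on f g S"
    have h: "?h \<in> ?F" and a: "a \<in> pverts G" using insert by auto
    have ga: "g a \<in> pverts H" using f(2) a by auto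
    have eq: "override_on f g (insert a S) = ?h(a := g a)"
      by (auto simp: override_on_def)
    have h': "?h(a := g a) \<in> ?F" using h a ga by (auto simp: PiE_iff extensional_def)
    have "(f, v) \<rightarrow>\<^sup>*\<^bsub>?W\<^esub> (?h, v)" using insert by auto
    also have "(?h, v) \<rightarrow>\<^sup>*\<^bsub>?W\<^esub> (?h, a)" by (rule move[OF h v a])
    also have "(?h, a) \<rightarrow>\<^sup>*\<^bsub>?W\<^esub> (?h(a := g a), a)" by (rule lamp[OF h a ga])
    also have "(?h(a := g a), a) \<rightarrow>\<^sup>*\<^bsub>?W\<^esub> (?h(a := g a), v)" by (rule move[OF h' a v])
    finally show ?case using h' unfolding eq by blast
  qed
  have reach: "(f, v) \<rightarrow>\<^sup>*\<^bsub>?W\<^esub> (g, w)"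
    if fg: "f \<in> ?F" "g \<in> ?F" and vw: "v \<in> pverts G" "w \<in> pverts G" for f g v w
  proof -
    have "override_on f g (pverts G) = g"
      using fg by (auto simp: override_on_def fun_eq_iff PiE_iff extensional_def)
    then have "(f, v) \<rightarrow>\<^sup>*\<^bsub>?W\<^esub> (g, v)"
      using upd[OF G.pair_finite_verts subset_refl fg vw(1)] by simp
    then show ?thesis using move[OF fg(2) vw] W.reachable_trans by blast
  qed
  have "pverts G \<noteq> {}" "pverts H \<noteq> {}"
    using assms(2,4) by (auto simp: connected_def strongly_connected_def mk_symmetric_def)
  then have ne: "pverts (wreath_product G H) \<noteq> {}"
    by (simp add: wreath_product_def PiE_eq_empty_iff)
  have "mk_symmetric ?W = wreath_product G H"
  proof -
    have "parcs (mk_symmetric ?W) = parcs (wreath_product G H)"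
      using W.pair_sym_arcs by (auto simp: mk_symmetric_def symmetric_def sym_def)
    then show ?thesis by (simp add: mk_symmetric_def)
  qed
  moreover have "strongly_connected ?W"
  proof (rule strongly_connectedI)
    show "verts ?W \<noteq> {}" using ne by simp
    fix x y assume "x \<in> verts ?W" "y \<in> verts ?W"
    then have "x \<in> ?F \<times> pverts G" "y \<in> ?F \<times> pverts G"
      by (simp_all add: wreath_product_def)
    then show "x \<rightarrow>\<^sup>*\<^bsub>?W\<^esub> y" using reach by blast
  qed
  ultimately show ?thesis by (simp add: connected_def)
qed

end

theory Submission
  imports Defs
begin

text \<open>
  To go from \<open>(f, v)\<close> to \<open>(g, w)\<close> in the wreath product, the base point has to walk from \<open>v\<close> to
  \<open>w\<close> through every vertex at which \<open>f\<close> and \<open>g\<close> differ, and the lamp at each vertex \<open>x\<close> has to be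
  moved from \<open>f x\<close> to \<open>g x\<close> at a cost of at least \<open>d\<^sub>H (f x) (g x)\<close>; both costs can be attained
  simultaneously by adjusting each lamp on a visit. Hence
  \<open>d ((f, v), (g, w)) = (\<Sum>x. d\<^sub>H (f x) (g x)) + \<rho>\<^sub>A v w\<close> with \<open>A = {x. f x \<noteq> g x}\<close>.
  Summing the first term fibrewise over the values \<open>(f x, g x)\<close>, and the second one over the
  \<open>(m - 1)\<^bsup>card A\<^esup>\<close> functions \<open>g\<close> that differ from \<open>f\<close> exactly on \<open>A\<close>, gives the formula.
\<close>

section \<open>Walks and the distances they attain\<close>

abbreviation walk :: "'a pair_pre_digraph \<Rightarrow> 'a \<Rightarrow> ('a \<times> 'a) list \<Rightarrow> 'a \<Rightarrow> bool" where
  "walk X \<equiv> pre_digraph.awalk (with_proj X)"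

abbreviation walk_verts :: "'a pair_pre_digraph \<Rightarrow> 'a \<Rightarrow> ('a \<times> 'a) list \<Rightarrow> 'a list" where
  "walk_verts X \<equiv> pre_digraph.awalk_verts (with_proj X)"

abbreviation differ_set :: "'a set \<Rightarrow> ('a \<Rightarrow> 'b) \<Rightarrow> ('a \<Rightarrow> 'b) \<Rightarrow> 'a set" where
  "differ_set V f g \<equiv> {x \<in> V. f x \<noteq> g x}"

lemma walk_Nil_iff:
  assumes "pair_graph X"
  shows "walk X u [] w \<longleftrightarrow> u = w \<and> u \<in> pverts X"
proof -
  interpret pair_graph X by fact
  show ?thesis by (auto simp: awalk_Nil_iff)
qed

lemma walk_Cons_iff:
  assumes "pair_graph X"
  shows "walk X u (e # p) w \<longleftrightarrow> e \<in> parcs X \<and> fst e = u \<and> walk X (snd e) p w"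
proof -
  interpret pair_graph X by fact
  show ?thesis by (auto simp: awalk_Cons_iff)
qed

lemma walk_append:
  assumes "pair_graph X" and "walk X u p v" and "walk X v q w"
  shows "walk X u (p @ q) w"
proof -
  interpret pair_graph X by fact
  show ?thesis using assms(2,3) by (rule awalk_appendI)
qed

lemma walk_verts_Nil: "walk_verts X u [] = [u]"
  by (simp add: pre_digraph.awalk_verts.simps)

lemma walk_verts_Cons: "walk_verts X u (e # p) = fst e # walk_verts X (snd e) p"
  by (simp add: pre_digraph.awalk_verts.simps)

lemma start_in_walk_verts:
  assumes "pair_graph X" and "walk X u p w"
  shows "u \<in> set (walk_verts X u p)"
  using assms by (cases p) (auto simp: walk_verts_Nil walk_verts_Cons walk_Cons_iff)

lemma geodesic_dist_le: "walk X u p v \<Longrightarrow> geodesic_dist X u v \<le> length p"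
  unfolding geodesic_dist_def by (rule Least_le) blast

lemma geodesic_dist_attained:
  assumes "pair_graph X" and "Digraph_Component.connected (with_proj X)"
    and "u \<in> pverts X" and "v \<in> pverts X"
  obtains p where "walk X u p v" and "length p = geodesic_dist X u v"
proof -
  have "\<exists>k p. walk X u p v \<and> length p = k" using connected_awalk_ex[OF assms] by blast
  from LeastI_ex[OF this] show ?thesis using that unfolding geodesic_dist_def by blast
qed

lemma visiting_dist_le:
  "walk X u p v \<Longrightarrow> A \<subseteq> set (walk_verts X u p) \<Longrightarrow> visiting_dist X A u v \<le> length p"
  unfolding visiting_dist_def by (rule Least_le) blast

lemma visiting_dist_attained:
  assumes "pair_graph X" and "Digraph_Component.connected (with_proj X)"
    and "u \<in> pverts X" and "v \<in> pverts X" and "A \<subseteq> pverts X"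
  obtains p where "walk X u p v" and "A \<subseteq> set (walk_verts X u p)"
    and "length p = visiting_dist X A u v"
proof -
  have "\<exists>k p. walk X u p v \<and> A \<subseteq> set (walk_verts X u p) \<and> length p = k"
    using connected_visiting_awalk_ex[OF assms] by blast
  from LeastI_ex[OF this] show ?thesis using that unfolding visiting_dist_def by blast
qed

lemma geodesic_dist_refl:
  assumes "pair_graph X" and "u \<in> pverts X"
  shows "geodesic_dist X u u = 0"
  using geodesic_dist_le[of X u "[]" u] assms by (simp add: walk_Nil_iff)

text \<open>Prepend the arc to a shortest walk from \<open>u'\<close>. This bounds how far a single
  lamp move can lower the lamp cost.\<close>

lemma geodesic_dist_arc:
  assumes "pair_graph X" and "Digraph_Component.connected (with_proj X)"
    and "(u, u') \<in> parcs X" and "v \<in> pverts X"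
  shows "geodesic_dist X u v \<le> Suc (geodesic_dist X u' v)"
proof -
  interpret pair_graph X by fact
  have "u' \<in> pverts X" using assms(3) by (auto dest: in_arcsD2)
  then obtain p where "walk X u' p v" "length p = geodesic_dist X u' v"
    using geodesic_dist_attained[OF assms(1,2) _ assms(4)] by blast
  then show ?thesis
    using geodesic_dist_le[of X u "(u, u') # p" v] assms(1,3) by (simp add: walk_Cons_iff)
qed

section \<open>Distances in the wreath product\<close>

lemma pverts_wreath_product:
  "pverts (wreath_product G H) = (pverts G \<rightarrow>\<^sub>E pverts H) \<times> pverts G"
  by (simp add: wreath_product_def)

lemma in_parcs_wreath_product_iff:
  "((f, v), (f', v')) \<in> parcs (wreath_product G H) \<longleftrightarrow>
    f \<in> pverts G \<rightarrow>\<^sub>E pverts H \<and> f' \<in> pverts G \<rightarrow>\<^sub>E pverts H \<and> v \<in> pverts G \<and> v' \<in> pverts G \<and>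
    (v = v' \<and> (\<forall>w \<in> pverts G. w \<noteq> v \<longrightarrow> f w = f' w) \<and> (f v, f' v) \<in> parcs H \<or>
     f = f' \<and> (v, v') \<in> parcs G)"
  by (auto simp: wreath_product_def)

locale wreath_factors =
  fixes G :: "'a pair_pre_digraph" and H :: "'b pair_pre_digraph"
  assumes pair_graph_G: "pair_graph G" and connected_G: "Digraph_Component.connected (with_proj G)"
    and pair_graph_H: "pair_graph H" and connected_H: "Digraph_Component.connected (with_proj H)"
begin

sublocale G: pair_graph G by (rule pair_graph_G)
sublocale H: pair_graph H by (rule pair_graph_H)
sublocale W: pair_graph "wreath_product G H"
  using pair_graph_G pair_graph_H by (rule pair_graph_wreath_product)

abbreviation "lamps \<equiv> pverts G \<rightarrow>\<^sub>E pverts H"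

text \<open>This is the geodesic distance in the Cartesian product of copies of \<open>H\<close>,
  one for each vertex of \<open>G\<close>.\<close>

definition lamp_cost :: "('a \<Rightarrow> 'b) \<Rightarrow> ('a \<Rightarrow> 'b) \<Rightarrow> nat" where
  "lamp_cost f g = (\<Sum>x \<in> pverts G. geodesic_dist H (f x) (g x))"

lemma lamp_cost_remove:
  "v \<in> pverts G \<Longrightarrow> lamp_cost f g =
    geodesic_dist H (f v) (g v) + (\<Sum>x \<in> pverts G - {v}. geodesic_dist H (f x) (g x))"
  unfolding lamp_cost_def by (rule sum.remove[OF G.pair_finite_verts])

text \<open>Only the summand at \<open>v\<close> changes, and it drops to 0. The lift uses this to
  charge the lamp walk at \<open>v\<close> exactly once.\<close>

lemma lamp_cost_upd:
  assumes "v \<in> pverts G" and "g \<in> lamps"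
  shows "lamp_cost f g = geodesic_dist H (f v) (g v) + lamp_cost (f(v := g v)) g"
proof -
  have "g v \<in> pverts H" using assms by auto
  then have "geodesic_dist H (g v) (g v) = 0" by (rule geodesic_dist_refl[OF pair_graph_H])
  moreover have "(\<Sum>x \<in> pverts G - {v}. geodesic_dist H ((f(v := g v)) x) (g x)) =
      (\<Sum>x \<in> pverts G - {v}. geodesic_dist H (f x) (g x))"
    by (rule sum.cong) auto
  ultimately have "lamp_cost (f(v := g v)) g =
      (\<Sum>x \<in> pverts G - {v}. geodesic_dist H (f x) (g x))"
    unfolding lamp_cost_remove[OF assms(1)] by simp
  then show ?thesis unfolding lamp_cost_remove[OF assms(1), of f] by simp
qed

text \<open>Keep only the arcs that move the base point. Each remaining arc moves one lamp along an
  arc of \<open>H\<close>, so it lowers the lamp cost by at most 1, and that lamp is the one at the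
  current base point. This yields the lower bound on the distance.\<close>

lemma wreath_walk_projection:
  assumes "walk (wreath_product G H) (f, v) p (g, w)"
  shows "\<exists>q. walk G v q w \<and> differ_set (pverts G) f g \<subseteq> set (walk_verts G v q) \<and>
    lamp_cost f g + length q \<le> length p"
  using assms
proof (induction p arbitrary: f v)
  case Nil
  then have fv: "f = g" "v = w" "g \<in> lamps" "w \<in> pverts G"
    by (auto simp: walk_Nil_iff[OF W.pair_graph_axioms] pverts_wreath_product)
  have "lamp_cost g g = 0" unfolding lamp_cost_def
    using fv by (intro sum.neutral ballI geodesic_dist_refl[OF pair_graph_H]) auto
  then show ?case using fv by (intro exI[of _ "[]"]) (simp add: walk_Nil_iff[OF pair_graph_G])
next
  case (Cons e p)
  obtain f' v' where e: "e = ((f, v), (f', v'))"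
    using Cons.prems by (cases e) (auto simp: walk_Cons_iff[OF W.pair_graph_axioms])
  have arc: "((f, v), (f', v')) \<in> parcs (wreath_product G H)"
    and p: "walk (wreath_product G H) (f', v') p (g, w)"
    using Cons.prems e by (auto simp: walk_Cons_iff[OF W.pair_graph_axioms])
  obtain q where q: "walk G v' q w" "differ_set (pverts G) f' g \<subseteq> set (walk_verts G v' q)"
    "lamp_cost f' g + length q \<le> length p"
    using Cons.IH[OF p] by blast
  have v: "v \<in> pverts G" using arc by (simp add: in_parcs_wreath_product_iff)
  have "(g, w) \<in> pverts (wreath_product G H)"
    using W.awalk_last_in_verts[OF p] by simp
  then have g: "g \<in> lamps" by (simp add: pverts_wreath_product)
  show ?case
  proof (cases "f = f' \<and> (v, v') \<in> parcs G")
    case True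
    then show ?thesis using q
      by (intro exI[of _ "(v, v') # q"])
        (auto simp: walk_Cons_iff[OF pair_graph_G] walk_verts_Cons)
  next
    case False
    \<comment> \<open>Here a lamp moves and the base point stays, so the walk \<open>q\<close> for
      the tail serves unchanged.\<close>
    then have v': "v' = v" and eq: "\<And>x. x \<in> pverts G \<Longrightarrow> x \<noteq> v \<Longrightarrow> f x = f' x"
      and fv: "(f v, f' v) \<in> parcs H"
      using arc by (auto simp: in_parcs_wreath_product_iff)
    have "geodesic_dist H (f v) (g v) \<le> Suc (geodesic_dist H (f' v) (g v))"
      using g v by (intro geodesic_dist_arc[OF pair_graph_H connected_H fv]) auto
    moreover have "(\<Sum>x \<in> pverts G - {v}. geodesic_dist H (f x) (g x)) =
        (\<Sum>x \<in> pverts G - {v}. geodesic_dist H (f' x) (g x))"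
      using eq by (intro sum.cong) auto
    ultimately have "lamp_cost f g \<le> Suc (lamp_cost f' g)"
      unfolding lamp_cost_remove[OF v] by simp
    moreover have "differ_set (pverts G) f g \<subseteq> set (walk_verts G v q)"
    proof
      fix x assume x: "x \<in> differ_set (pverts G) f g"
      show "x \<in> set (walk_verts G v q)"
      \<comment> \<open>The functions \<open>f\<close> and \<open>f'\<close> can disagree only at
        \<open>v\<close>, and \<open>q\<close> starts there.\<close>
      proof (cases "x = v")
        case True
        then show ?thesis using start_in_walk_verts[OF pair_graph_G q(1)] v' by blast
      next
        case False
        then have "x \<in> differ_set (pverts G) f' g" using x eq[of x] by force
        then show ?thesis using q(2) v' by blast
      qed
    qed
    moreover have "walk G v q w" using q(1) v' by simp
    ultimately show ?thesis using q(3) by (intro exI[of _ q] conjI) simp_all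
  qed
qed

text \<open>With the base point \<open>v\<close> and all other lamps fixed, the lamp at
  \<open>v\<close> ranges over a copy of \<open>H\<close> inside the wreath product.\<close>

lemma lamp_walk:
  assumes "walk H (f v) q b" and "f \<in> lamps" and "v \<in> pverts G"
  shows "\<exists>p. walk (wreath_product G H) (f, v) p (f(v := b), v) \<and> length p = length q"
  using assms
proof (induction q arbitrary: f)
  case Nil
  then show ?case
    by (intro exI[of _ "[]"])
      (auto simp: walk_Nil_iff[OF pair_graph_H] walk_Nil_iff[OF W.pair_graph_axioms]
        pverts_wreath_product)
next
  case (Cons e q)
  obtain c where e: "e = (f v, c)" and arc: "(f v, c) \<in> parcs H" and q: "walk H c q b"
    using Cons.prems(1) by (cases e) (auto simp: walk_Cons_iff[OF pair_graph_H])
  let ?f = "f(v := c)"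
  have f: "?f \<in> lamps"
    using Cons.prems(2,3) arc by (auto simp: PiE_iff extensional_def dest: H.in_arcsD2)
  \<comment> \<open>The induction hypothesis expects a walk from \<open>(f(v := c)) v\<close>, which
    is \<open>c\<close>.\<close>
  obtain p where p: "walk (wreath_product G H) (?f, v) p (?f(v := b), v)" "length p = length q"
    using Cons.IH[OF _ f Cons.prems(3)] q fun_upd_same[of f v c] by metis
  have "((f, v), (?f, v)) \<in> parcs (wreath_product G H)"
    using f arc Cons.prems(2,3) by (simp add: in_parcs_wreath_product_iff)
  then show ?case using p e
    by (intro exI[of _ "((f, v), (?f, v)) # p"])
      (simp add: walk_Cons_iff[OF W.pair_graph_axioms] del: fun_upd_apply)
qed

text \<open>Follow \<open>q\<close> and, at each vertex reached, first set its lamp to the final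
  value along a shortest walk in \<open>H\<close>. On a later visit that walk is empty, so each lamp
  is paid for once. The lamps change along the way, hence the induction over arbitrary
  \<open>f\<close>.\<close>

lemma wreath_walk_lift:
  assumes "walk G v q w" and "differ_set (pverts G) f g \<subseteq> set (walk_verts G v q)"
    and "f \<in> lamps" and "g \<in> lamps"
  shows "\<exists>p. walk (wreath_product G H) (f, v) p (g, w) \<and> length p = lamp_cost f g + length q"
  using assms
proof (induction q arbitrary: f v)
  case Nil
  then have v: "v = w" "v \<in> pverts G" by (auto simp: walk_Nil_iff[OF pair_graph_G])
  have "f v \<in> pverts H" "g v \<in> pverts H" using Nil.prems v by auto
  then obtain r where r: "walk H (f v) r (g v)" "length r = geodesic_dist H (f v) (g v)"
    using geodesic_dist_attained[OF pair_graph_H connected_H] by blast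
  \<comment> \<open>The empty walk visits only \<open>v\<close>, so \<open>f\<close> and
    \<open>g\<close> differ at most there.\<close>
  have fg: "f(v := g v) = g"
  proof (rule PiE_ext)
    show "f(v := g v) \<in> lamps" using Nil.prems(3,4) v by (auto simp: PiE_iff extensional_def)
    show "g \<in> lamps" by fact
    show "(f(v := g v)) x = g x" if "x \<in> pverts G" for x
      using Nil.prems(2) that by (auto simp: walk_verts_Nil)
  qed
  have "lamp_cost g g = 0" unfolding lamp_cost_def
    using Nil.prems(4) by (intro sum.neutral ballI geodesic_dist_refl[OF pair_graph_H]) auto
  then have "lamp_cost f g = length r"
    using lamp_cost_upd[OF v(2) Nil.prems(4), of f] fg r(2) by simp
  then show ?case using lamp_walk[OF r(1) Nil.prems(3) v(2)] fg v(1) by auto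
next
  case (Cons e q)
  obtain v' where e: "e = (v, v')" and arc: "(v, v') \<in> parcs G" and q: "walk G v' q w"
    using Cons.prems(1) by (cases e) (auto simp: walk_Cons_iff[OF pair_graph_G])
  have v: "v \<in> pverts G" "v' \<in> pverts G" using arc by (auto dest: G.in_arcsD1 G.in_arcsD2)
  have "f v \<in> pverts H" "g v \<in> pverts H" using Cons.prems v by auto
  then obtain r where r: "walk H (f v) r (g v)" "length r = geodesic_dist H (f v) (g v)"
    using geodesic_dist_attained[OF pair_graph_H connected_H] by blast
  let ?f = "f(v := g v)"
  have f: "?f \<in> lamps" using Cons.prems(3,4) v by (auto simp: PiE_iff extensional_def)
  \<comment> \<open>Once its lamp is set, \<open>v\<close> no longer differs, so the tail
    \<open>q\<close> need not return to it.\<close>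
  have "differ_set (pverts G) ?f g \<subseteq> set (walk_verts G v' q)"
    using Cons.prems(2) e by (auto simp: walk_verts_Cons)
  then obtain p where p: "walk (wreath_product G H) (?f, v') p (g, w)"
    "length p = lamp_cost ?f g + length q"
    using Cons.IH[OF q _ f Cons.prems(4)] by blast
  obtain s where s: "walk (wreath_product G H) (f, v) s (?f, v)" "length s = length r"
    using lamp_walk[OF r(1) Cons.prems(3) v(1)] by blast
  have "((?f, v), (?f, v')) \<in> parcs (wreath_product G H)"
    using f v arc by (simp add: in_parcs_wreath_product_iff)
  then have "walk (wreath_product G H) (?f, v) (((?f, v), (?f, v')) # p) (g, w)"
    using p(1) by (simp add: walk_Cons_iff[OF W.pair_graph_axioms])
  \<comment> \<open>The lift consists of the lamp walk \<open>s\<close>, one base arc and the lifted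
    tail \<open>p\<close>.\<close>
  then have "walk (wreath_product G H) (f, v) (s @ ((?f, v), (?f, v')) # p) (g, w)"
    using s(1) by (intro walk_append[OF W.pair_graph_axioms])
  moreover have "length (s @ ((?f, v), (?f, v')) # p) = lamp_cost f g + length (e # q)"
    using p(2) s(2) r(2) lamp_cost_upd[OF v(1) Cons.prems(4), of f] by simp
  ultimately show ?case by blast
qed

lemma geodesic_dist_wreath_product:
  assumes "f \<in> lamps" and "g \<in> lamps" and "v \<in> pverts G" and "w \<in> pverts G"
  shows "geodesic_dist (wreath_product G H) (f, v) (g, w) =
    lamp_cost f g + visiting_dist G (differ_set (pverts G) f g) v w" (is "?d = ?r")
proof (rule antisym)
  \<comment> \<open>Upper bound: lift a shortest visiting walk.\<close>
  obtain q where q: "walk G v q w" "differ_set (pverts G) f g \<subseteq> set (walk_verts G v q)"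
    "length q = visiting_dist G (differ_set (pverts G) f g) v w"
    using visiting_dist_attained[OF pair_graph_G connected_G assms(3,4),
        of "differ_set (pverts G) f g"] by blast
  show "?d \<le> ?r"
    using wreath_walk_lift[OF q(1,2) assms(1,2)] q(3) geodesic_dist_le by metis
next
  \<comment> \<open>Lower bound: project a geodesic of the wreath product.\<close>
  have "(f, v) \<in> pverts (wreath_product G H)" "(g, w) \<in> pverts (wreath_product G H)"
    using assms by (simp_all add: pverts_wreath_product)
  then obtain p where p: "walk (wreath_product G H) (f, v) p (g, w)" "length p = ?d"
    using geodesic_dist_attained[OF W.pair_graph_axioms connected_wreath_product[OF
          pair_graph_G connected_G pair_graph_H connected_H]] by blast
  obtain q where q: "walk G v q w" "differ_set (pverts G) f g \<subseteq> set (walk_verts G v q)"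
    "lamp_cost f g + length q \<le> length p"
    using wreath_walk_projection[OF p(1)] by blast
  show "?r \<le> ?d" using visiting_dist_le[OF q(1,2)] q(3) p(2) by linarith
qed

end

section \<open>Sums over function spaces\<close>

lemma sum_PiE_component:
  fixes h :: "'b \<Rightarrow> real"
  assumes "finite V" and "finite S" and "x \<in> V"
  shows "(\<Sum>f \<in> V \<rightarrow>\<^sub>E S. h (f x)) = real (card S) ^ (card V - 1) * (\<Sum>a \<in> S. h a)"
proof -
  have fiber: "card {f \<in> V \<rightarrow>\<^sub>E S. f x = a} = card S ^ (card V - 1)" if "a \<in> S" for a
  proof -
    \<comment> \<open>Prescribing the value at \<open>x\<close> makes that factor a singleton, so
      the fibre is again a product and \<open>card_PiE\<close> applies. The other
      \<open>card V - 1\<close> coordinates stay free.\<close>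
    have "{f \<in> V \<rightarrow>\<^sub>E S. f x = a} = (\<Pi>\<^sub>E y \<in> V. if y = x then {a} else S)"
      (is "?L = ?R")
    proof (intro set_eqI iffI)
      show "f \<in> ?R" if "f \<in> ?L" for f using that by (auto simp: PiE_iff)
      show "f \<in> ?L" if f: "f \<in> ?R" for f
      proof -
        have "f y \<in> (if y = x then {a} else S)" if "y \<in> V" for y using f that by blast
        then have "f x = a" "\<And>y. y \<in> V \<Longrightarrow> f y \<in> S"
          using assms(3) \<open>a \<in> S\<close> by (force split: if_splits)+
        then show ?thesis using f by (auto simp: PiE_iff)
      qed
    qed
    then have "card {f \<in> V \<rightarrow>\<^sub>E S. f x = a} = (\<Prod>y \<in> V. card (if y = x then {a} else S))"
      using assms(1) by (simp add: card_PiE)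
    also have "\<dots> = (\<Prod>y \<in> V - {x}. card S)"
      unfolding prod.remove[OF assms(1,3)] by (auto intro!: prod.cong)
    finally show ?thesis using assms(1,3) by simp
  qed
  have "(\<Sum>f \<in> V \<rightarrow>\<^sub>E S. h (f x)) = (\<Sum>a \<in> S. \<Sum>f \<in> {f \<in> V \<rightarrow>\<^sub>E S. f x = a}. h (f x))"
    using assms by (intro sum.group[symmetric] finite_PiE) auto
  also have "\<dots> = (\<Sum>a \<in> S. real (card S) ^ (card V - 1) * h a)"
    by (intro sum.cong refl) (simp add: fiber)
  finally show ?thesis by (simp add: sum_distrib_left)
qed

lemma sum_PiE_component2:
  fixes h :: "'b \<Rightarrow> 'b \<Rightarrow> real"
  assumes "finite V" and "finite S" and "x \<in> V"
  shows "(\<Sum>f \<in> V \<rightarrow>\<^sub>E S. \<Sum>g \<in> V \<rightarrow>\<^sub>E S. h (f x) (g x)) =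
    real (card S) ^ (2 * (card V - 1)) * (\<Sum>a \<in> S. \<Sum>b \<in> S. h a b)"
proof -
  \<comment> \<open>The one-variable formula is applied to \<open>g\<close> with \<open>f\<close>
    fixed, then to \<open>f\<close>; each use gives one power of \<open>card S\<close>.\<close>
  have "(\<Sum>f \<in> V \<rightarrow>\<^sub>E S. \<Sum>g \<in> V \<rightarrow>\<^sub>E S. h (f x) (g x)) =
      (\<Sum>f \<in> V \<rightarrow>\<^sub>E S. real (card S) ^ (card V - 1) * (\<Sum>b \<in> S. h (f x) b))"
    by (simp add: sum_PiE_component[OF assms])
  also have "\<dots> = real (card S) ^ (card V - 1) *
      (\<Sum>a \<in> S. real (card S) ^ (card V - 1) * (\<Sum>b \<in> S. h a b))"
    by (simp add: sum_PiE_component[OF assms, of "\<lambda>a. \<Sum>b \<in> S. h a b"] sum_distrib_left[symmetric])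
  finally show ?thesis by (simp add: sum_distrib_left[symmetric] mult_2 power_add)
qed

text \<open>The values of \<open>g\<close> are chosen independently: any element of \<open>S\<close>
  except \<open>f x\<close> on \<open>A\<close>, and \<open>f x\<close> itself elsewhere. For a
  singleton \<open>S\<close> and empty \<open>A\<close> the count is \<open>0 ^ 0 = 1\<close>,
  namely \<open>f\<close> alone.\<close>

lemma card_differ_set_eq:
  assumes "finite V" and "finite S" and "f \<in> V \<rightarrow>\<^sub>E S" and "A \<subseteq> V"
  shows "card {g \<in> V \<rightarrow>\<^sub>E S. differ_set V f g = A} = (card S - 1) ^ card A"
proof -
  have "{g \<in> V \<rightarrow>\<^sub>E S. differ_set V f g = A} = (\<Pi>\<^sub>E x \<in> V. if x \<in> A then S - {f x} else {f x})"
    (is "?L = ?R")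
  proof (intro set_eqI iffI)
    fix g assume "g \<in> ?L"
    then show "g \<in> ?R" by (auto simp: PiE_iff)
  next
    fix g assume g: "g \<in> ?R"
    then have *: "g x \<in> (if x \<in> A then S - {f x} else {f x})" if "x \<in> V" for x
      using that by blast
    have "g x \<in> S" if "x \<in> V" for x
      using *[OF that] PiE_mem[OF assms(3) that] by (auto split: if_splits)
    moreover have "differ_set V f g = A"
    proof (intro set_eqI iffI)
      show "x \<in> A" if "x \<in> differ_set V f g" for x
        using that *[of x] by (auto split: if_splits)
      show "x \<in> differ_set V f g" if "x \<in> A" for x
        using that *[of x] assms(4) by auto
    qed
    ultimately show "g \<in> ?L" using g by (auto simp: PiE_iff)
  qed
  then have "card ?L = (\<Prod>x \<in> V. card (if x \<in> A then S - {f x} else {f x}))"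
    using assms(1) by (simp add: card_PiE)
  also have "\<dots> = (\<Prod>x \<in> V. if x \<in> A then card S - 1 else 1)"
    by (intro prod.cong refl) (simp add: card_Diff_singleton PiE_mem[OF assms(3)])
  also have "\<dots> = (\<Prod>x \<in> V \<inter> A. card S - 1)" by (rule prod.inter_restrict[OF assms(1), symmetric])
  finally show ?thesis using assms(4) by (simp add: Int_absorb1)
qed

text \<open>Grouping the \<open>g\<close> by their difference set gives an inner sum independent of
  \<open>f\<close>, so the outer sum only multiplies it by the number of functions.\<close>

lemma sum_PiE_differ_set:
  fixes h :: "'a set \<Rightarrow> real"
  assumes "finite V" and "finite S" and "S \<noteq> {}"
  shows "(\<Sum>f \<in> V \<rightarrow>\<^sub>E S. \<Sum>g \<in> V \<rightarrow>\<^sub>E S. h (differ_set V f g)) =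
    real (card S) ^ card V * (\<Sum>A \<in> Pow V. (real (card S) - 1) ^ card A * h A)"
proof -
  \<comment> \<open>With this, the natural number \<open>card S - 1\<close> becomes
    \<open>real (card S) - 1\<close> under the embedding into the reals.\<close>
  have S: "1 \<le> card S" using assms(2,3) by (simp add: Suc_le_eq card_gt_0_iff)
  have "(\<Sum>g \<in> V \<rightarrow>\<^sub>E S. h (differ_set V f g)) = (\<Sum>A \<in> Pow V. (real (card S) - 1) ^ card A * h A)"
    if f: "f \<in> V \<rightarrow>\<^sub>E S" for f
  proof -
    have "(\<Sum>g \<in> V \<rightarrow>\<^sub>E S. h (differ_set V f g)) =
        (\<Sum>A \<in> Pow V. \<Sum>g \<in> {g \<in> V \<rightarrow>\<^sub>E S. differ_set V f g = A}. h (differ_set V f g))"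
      using assms by (intro sum.group[symmetric] finite_PiE) auto
    also have "\<dots> = (\<Sum>A \<in> Pow V. real (card {g \<in> V \<rightarrow>\<^sub>E S. differ_set V f g = A}) * h A)"
      by (intro sum.cong refl) simp
    also have "\<dots> = (\<Sum>A \<in> Pow V. (real (card S) - 1) ^ card A * h A)"
      using S by (intro sum.cong refl) (simp add: card_differ_set_eq[OF assms(1,2) f])
    finally show ?thesis .
  qed
  then show ?thesis using assms(1) by (simp add: card_PiE)
qed

theorem theorem5p4:
  fixes G :: "'a pair_pre_digraph" and H :: "'b pair_pre_digraph" and n m :: nat
  assumes "pair_graph G" and "Digraph_Component.connected (with_proj G)"
    and "pair_graph H" and "Digraph_Component.connected (with_proj H)"
    and "card (pverts G) = n" and "card (pverts H) = m"
  shows "wiener_index (wreath_product G H) =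
    real n ^ 3 * real m ^ (2 * (n - 1)) * wiener_index H
    + real m ^ n * (\<Sum>A \<in> Pow (pverts G). (real m - 1) ^ card A * visiting_wiener_index G A)"
proof -
  interpret wreath_factors G H using assms(1-4) by (rule wreath_factors.intro)
  let ?V = "pverts G" and ?S = "pverts H"
  let ?dH = "\<lambda>a b. real (geodesic_dist H a b)"
  let ?R = "\<lambda>A. \<Sum>v \<in> ?V. \<Sum>w \<in> ?V. real (visiting_dist G A v w)"
  \<comment> \<open>Connectedness includes having at least one vertex.\<close>
  have S: "?S \<noteq> {}"
    using connected_H by (auto simp: connected_def strongly_connected_def mk_symmetric_def)
  \<comment> \<open>Every vertex \<open>x\<close> of \<open>G\<close> contributes the same amount,
    whence the factor \<open>n\<close>.\<close>
  have cost: "(\<Sum>f \<in> lamps. \<Sum>g \<in> lamps. real (lamp_cost f g)) =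
      real n * real m ^ (2 * (n - 1)) * (\<Sum>a \<in> ?S. \<Sum>b \<in> ?S. ?dH a b)"
  proof -
    have "(\<Sum>f \<in> lamps. \<Sum>g \<in> lamps. real (lamp_cost f g)) =
        (\<Sum>f \<in> lamps. \<Sum>x \<in> ?V. \<Sum>g \<in> lamps. ?dH (f x) (g x))"
      unfolding lamp_cost_def of_nat_sum by (rule sum.cong[OF refl], rule sum.swap)
    also have "\<dots> = (\<Sum>x \<in> ?V. \<Sum>f \<in> lamps. \<Sum>g \<in> lamps. ?dH (f x) (g x))"
      by (rule sum.swap)
    also have "\<dots> = (\<Sum>x \<in> ?V. real m ^ (2 * (n - 1)) * (\<Sum>a \<in> ?S. \<Sum>b \<in> ?S. ?dH a b))"
      unfolding assms(5,6)[symmetric]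
      by (rule sum.cong[OF refl],
          rule sum_PiE_component2[OF G.pair_finite_verts H.pair_finite_verts])
    finally show ?thesis by (simp add: assms(5))
  qed
  have "(\<Sum>x \<in> pverts (wreath_product G H). \<Sum>y \<in> pverts (wreath_product G H).
        real (geodesic_dist (wreath_product G H) x y)) =
      (\<Sum>f \<in> lamps. \<Sum>v \<in> ?V. \<Sum>g \<in> lamps. \<Sum>w \<in> ?V.
        real (geodesic_dist (wreath_product G H) (f, v) (g, w)))"
    unfolding pverts_wreath_product sum.cartesian_product' ..
  also have "\<dots> = (\<Sum>f \<in> lamps. \<Sum>g \<in> lamps. \<Sum>v \<in> ?V. \<Sum>w \<in> ?V.
        real (geodesic_dist (wreath_product G H) (f, v) (g, w)))"
    by (rule sum.cong[OF refl], rule sum.swap)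
  \<comment> \<open>The lamp cost does not depend on \<open>v\<close> and \<open>w\<close>, so it is
    counted \<open>n ^ 2\<close> times; with the factor \<open>n\<close> from \<open>cost\<close>
    this makes \<open>n ^ 3\<close>.\<close>
  also have "\<dots> = (\<Sum>f \<in> lamps. \<Sum>g \<in> lamps.
      real n ^ 2 * real (lamp_cost f g) + ?R (differ_set ?V f g))"
    by (intro sum.cong refl)
      (simp add: geodesic_dist_wreath_product sum.distrib assms(5) power2_eq_square)
  also have "\<dots> = real n ^ 2 * (\<Sum>f \<in> lamps. \<Sum>g \<in> lamps. real (lamp_cost f g)) +
      (\<Sum>f \<in> lamps. \<Sum>g \<in> lamps. ?R (differ_set ?V f g))"
    by (simp add: sum.distrib sum_distrib_left)
  also have "\<dots> = real n ^ 3 * real m ^ (2 * (n - 1)) * (\<Sum>a \<in> ?S. \<Sum>b \<in> ?S. ?dH a b) +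
      real m ^ n * (\<Sum>A \<in> Pow ?V. (real m - 1) ^ card A * ?R A)"
    unfolding cost sum_PiE_differ_set[OF G.pair_finite_verts H.pair_finite_verts S, of ?R] assms(5,6)
    by (simp add: power2_eq_square power3_eq_cube mult.assoc)
  \<comment> \<open>Halving both sides produces the Wiener indices, the factor 1/2 passing into the
    sum over \<open>A\<close>.\<close>
  finally show ?thesis
    by (simp add: wiener_index_def visiting_wiener_index_def sum_divide_distrib[symmetric]
        add_divide_distrib)
qed

end
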